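(* Let $g$ be an entire function such that $g^m$ is an $E$-function for some integer $m\geq 1$. Let $L\in\overline{\mathbb Q}(x)[d/dx]$ be a differential operator such that $L(g)/g$ is an entire function. Then $L(g)/g\in\overline{\mathbb Q}[x]$.
   Context: $\overline{\mathbb Q}$ is embedded in $\mathbb C$. A power series $f(x)=\sum_{n\ge0}a_n x^n/n!\in\overline{\mathbb Q}[[x]]$ is an $E$-function if: (i) $f$ satisfies a non-zero linear differential equation with coefficients in $\overline{\mathbb Q}(x)$; (ii) there is $C_1>0$ such that all Galois conjugates of $a_n$ have modulus $\le C_1^{n+1}$ for all $n\ge0$; (iii) there are $C_2>0$ and positive integers $d_n\le C_2^{n+1}$ such that $d_na_m$ is an algebraic integer for all $m\le n$. $E$-functions are entire. *)

theory Defs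
  imports
    "HOL-Complex_Analysis.Complex_Analysis"
    "HOL-Computational_Algebra.Computational_Algebra"
    "HOL-Computational_Algebra.Field_as_Ring"
begin

text \<open>
  The field of algebraic numbers is taken inside the type of complex numbers, and
  \<^term>\<open>ratfun_Qbar\<close> is its field of rational functions, inside the field of fractions of
  complex polynomials.
\<close>

definition poly_Qbar :: "complex poly set" where
  "poly_Qbar = {p. \<forall>i. algebraic (coeff p i)}"

definition ratfun_Qbar :: "complex poly fract set" where
  "ratfun_Qbar = {Fraction_Field.Fract p q | p q. p \<in> poly_Qbar \<and> q \<in> poly_Qbar \<and> q \<noteq> 0}"

text \<open>
  A differential operator $\sum_i c_i (d/dx)^i$ with rational coefficients is represented by the
  polynomial with coefficients $c_i$. Only the coefficients matter; the (commutative)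
  multiplication of this type is not the composition of operators.
\<close>

definition diffop_Qbar :: "complex poly fract poly set" where
  "diffop_Qbar = {L. \<forall>i. coeff L i \<in> ratfun_Qbar}"

text \<open>
  Operators act in two ways: formally on Laurent series at 0 and pointwise on functions. The
  numerator and denominator given by \<^const>\<open>quot_of_fract\<close> are coprime, so the pointwise value of
  a rational function is the expected one outside its poles; at a pole it is 0.
\<close>

definition fls_of_ratfun :: "complex poly fract \<Rightarrow> complex fls" where
  "fls_of_ratfun r = fps_to_fls (fps_of_poly (fst (quot_of_fract r))) /
                     fps_to_fls (fps_of_poly (snd (quot_of_fract r)))"

definition eval_ratfun :: "complex poly fract \<Rightarrow> complex \<Rightarrow> complex" where
  "eval_ratfun r z = poly (fst (quot_of_fract r)) z / poly (snd (quot_of_fract r)) z"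

definition diffop_fls :: "complex poly fract poly \<Rightarrow> complex fls \<Rightarrow> complex fls" where
  "diffop_fls L F = (\<Sum>i\<le>degree L. fls_of_ratfun (coeff L i) * (fls_deriv ^^ i) F)"

definition diffop_fun ::
    "complex poly fract poly \<Rightarrow> (complex \<Rightarrow> complex) \<Rightarrow> complex \<Rightarrow> complex" where
  "diffop_fun L f z = (\<Sum>i\<le>degree L. eval_ratfun (coeff L i) z * (deriv ^^ i) f z)"

definition galois_conjugate :: "complex \<Rightarrow> complex \<Rightarrow> bool" where
  "galois_conjugate x y \<longleftrightarrow>
     (\<exists>p :: rat poly. irreducible p \<and>
        poly (map_poly of_rat p) x = 0 \<and> poly (map_poly of_rat p) y = 0)"

text \<open>The numbers $a_n$ of the definition of an E-function $\sum_n a_n x^n / n!$.\<close>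

definition egf_coeff :: "complex fps \<Rightarrow> nat \<Rightarrow> complex" where
  "egf_coeff F n = fact n * fps_nth F n"

definition E_function :: "complex fps \<Rightarrow> bool" where
  "E_function F \<longleftrightarrow>
     (\<forall>n. algebraic (egf_coeff F n)) \<and>
     (\<exists>L\<in>diffop_Qbar. L \<noteq> 0 \<and> diffop_fls L (fps_to_fls F) = 0) \<and>
     (\<exists>C\<^sub>1>0. \<forall>n y. galois_conjugate (egf_coeff F n) y \<longrightarrow> norm y \<le> C\<^sub>1 ^ (n + 1)) \<and>
     (\<exists>C\<^sub>2>0. \<exists>d :: nat \<Rightarrow> nat.
        (\<forall>n. d n > 0 \<and> real (d n) \<le> C\<^sub>2 ^ (n + 1)) \<and>
        (\<forall>n. \<forall>m\<le>n. algebraic_int (of_nat (d n) * egf_coeff F m)))"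

lemma quot_of_fract_cross:
  fixes p q :: "complex poly"
  assumes "q \<noteq> 0"
  shows "p * snd (quot_of_fract (Fraction_Field.Fract p q)) = fst (quot_of_fract (Fraction_Field.Fract p q)) * q"
    and "snd (quot_of_fract (Fraction_Field.Fract p q)) \<noteq> 0"
proof -
  define a where "a = fst (quot_of_fract (Fraction_Field.Fract p q))"
  define b where "b = snd (quot_of_fract (Fraction_Field.Fract p q))"
  show b: "snd (quot_of_fract (Fraction_Field.Fract p q)) \<noteq> 0"
    by (rule snd_quot_of_fract_nonzero)
  have "quot_to_fract (a, b) = Fraction_Field.Fract p q"
    by (simp add: a_def b_def)
  hence "Fraction_Field.Fract a b = Fraction_Field.Fract p q"
    by (simp add: quot_to_fract_def)
  hence "a * q = p * b"
    using b assms by (subst (asm) Fraction_Field.eq_fract(1)) (simp_all only: b_def not_False_eq_True)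
  thus "p * snd (quot_of_fract (Fraction_Field.Fract p q)) = fst (quot_of_fract (Fraction_Field.Fract p q)) * q"
    by (simp only: a_def b_def)
qed

lemma fls_of_ratfun_Fract:
  assumes "q \<noteq> 0"
  shows "fls_of_ratfun (Fraction_Field.Fract p q) =
           fps_to_fls (fps_of_poly p) / fps_to_fls (fps_of_poly q)"
proof -
  have "fps_to_fls (fps_of_poly (p * snd (quot_of_fract (Fraction_Field.Fract p q)))) =
        fps_to_fls (fps_of_poly (fst (quot_of_fract (Fraction_Field.Fract p q)) * q))"
    by (simp only: quot_of_fract_cross(1)[OF assms])
  thus ?thesis
    using quot_of_fract_cross(2)[OF assms, of p] assms
    by (simp add: fls_of_ratfun_def fps_of_poly_mult fls_times_fps_to_fls
        nonzero_divide_eq_eq nonzero_eq_divide_eq field_simps)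
qed

lemma eval_ratfun_Fract:
  assumes "poly q z \<noteq> 0"
  shows "eval_ratfun (Fraction_Field.Fract p q) z = poly p z / poly q z"
proof -
  define a where "a = fst (quot_of_fract (Fraction_Field.Fract p q))"
  define b where "b = snd (quot_of_fract (Fraction_Field.Fract p q))"
  have q: "q \<noteq> 0" using assms by auto
  have cop: "coprime a b"
    unfolding a_def b_def by (rule coprime_quot_of_fract)
  have eq: "p * b = a * q"
    using quot_of_fract_cross(1)[OF q] by (simp add: a_def b_def)
  hence "b dvd q"
    using cop by (metis coprime_commute coprime_dvd_mult_right_iff dvd_triv_right)
  hence "poly b z \<noteq> 0"
    using assms by (auto elim!: dvdE)
  moreover have "poly p z * poly b z = poly a z * poly q z"
    using arg_cong[OF eq, of "\<lambda>r. poly r z"] by simp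
  ultimately show ?thesis
    using assms by (simp add: eval_ratfun_def a_def b_def field_simps)
qed

end

(*
  The E-function g^m is of exponential type, hence so is g. For an entire function g of
  exponential type every quotient g^(k) / g of a derivative is bounded by a power of |z| on circles of
  arbitrarily large radius (a pointwise form of the lemma on the logarithmic derivative). Hence
  so is the entire function h = L(g) / g, and h is a polynomial by the maximum principle and
  Liouville's theorem. The Taylor coefficients of g^m at 0 are algebraic, hence those of g are,
  and then those of the power series L(g) / g.
*)
theory Submission
  imports Defs
begin

text \<open>The obstacle is the zeros of \<open>g\<close>: quotients such as g' / g have poles
  there, so circles through zeros are useless. Exponential type allows only O(R) zeros in the disc
  of radius R, hence some circle of radius comparable to R keeps a controlled distance from all of
  them. On discs of radius of order 1/R around the points of that circle, \<open>g\<close> varies by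
  a bounded factor only, and Cauchy's inequality turns this into a bound of order R^k for the k-th
  quotient, for all k at once. The maximum principle for the entire function \<open>h\<close> then
  covers the points off the chosen circles.

  On the arithmetic side, passing from \<open>g ^ m\<close> to \<open>g\<close> and dividing by
  \<open>g\<close> are triangular recursions for Taylor coefficients. They stay within the algebraic
  numbers by the field operations; only the leading coefficient of \<open>g\<close> requires a root.

  \<open>h\<close> agrees with the quotient only off a sparse set, so both sides work with the
  identity of entire functions obtained by clearing denominators.\<close>

subsection \<open>Sums and products of algebraic numbers\<close>

text \<open>
  A constant of its own: otherwise the simplification rules of the interpretation below would
  match every product of complex numbers.
\<close>

definition qscale :: "rat \<Rightarrow> complex \<Rightarrow> complex" where
  "qscale r x = of_rat r * x"

interpretation Qspace: vector_space qscale
  by unfold_locales (simp_all add: qscale_def algebra_simps of_rat_add of_rat_mult)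

text \<open>All powers of \<open>x\<close> stay in a space of dimension at most
  \<open>card B\<close>, so the first \<open>card B + 1\<close> of them satisfy a nontrivial
  rational relation, which is a polynomial with root \<open>x\<close>.\<close>

lemma algebraic_if_mult_closed_span:
  fixes x :: complex
  assumes fin: "finite B" and one: "1 \<in> Qspace.span B"
    and mult: "\<And>b. b \<in> B \<Longrightarrow> x * b \<in> Qspace.span B"
  shows "algebraic x"
proof -
  have mult': "x * v \<in> Qspace.span B" if "v \<in> Qspace.span B" for v
    using that
  proof (induction rule: Qspace.span_induct_alt)
    case (step c u v)
    have "x * (qscale c u + v) = qscale c (x * u) + x * v" by (simp add: qscale_def algebra_simps)
    thus ?case using step mult by (simp add: Qspace.span_add Qspace.span_scale)
  qed (simp add: Qspace.span_zero)
  have pow: "x ^ n \<in> Qspace.span B" for n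
    by (induction n) (auto simp: one intro: mult')
  define S where "S = (\<lambda>n. x ^ n) ` {..card B}"
  show ?thesis
  \<comment> \<open>Dependence is a property of the set of powers, so coinciding powers are treated
    apart; they give a binomial with root \<open>x\<close>.\<close>
  proof (cases "inj_on (\<lambda>n. x ^ n) {..card B}")
    case False
    then obtain i j where ij: "x ^ i = x ^ j" "i < j"
      by (metis inj_onI linorder_cases)
    define p :: "complex poly" where "p = monom 1 j - monom 1 i"
    have "coeff p j = 1" using ij by (simp add: p_def)
    hence "p \<noteq> 0" by auto
    moreover have "poly p x = 0" using ij by (simp add: p_def poly_monom)
    moreover have "coeff p k \<in> \<rat>" for k by (simp add: p_def)
    ultimately show ?thesis by (intro algebraicI')
  next
    case inj: True
    hence "card S = Suc (card B)" by (simp add: S_def card_image)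
    hence "Qspace.dependent S"
      using Qspace.independent_span_bound[OF fin, of S] pow by (auto simp: S_def)
    then obtain u v where u: "(\<Sum>v\<in>S. of_rat (u v) * v) = 0" and v: "v \<in> S" "u v \<noteq> 0"
      using Qspace.dependent_finite[of S] by (auto simp: S_def qscale_def)
    define p :: "complex poly" where "p = (\<Sum>n\<le>card B. monom (of_rat (u (x ^ n))) n)"
    have cf: "coeff p k = (if k \<le> card B then of_rat (u (x ^ k)) else 0)" for k
      by (simp add: p_def coeff_sum)
    have "poly p x = (\<Sum>v\<in>S. of_rat (u v) * v)"
      using inj by (simp add: p_def poly_sum poly_monom S_def sum.reindex)
    moreover from v obtain k where "k \<le> card B" "v = x ^ k" by (auto simp: S_def)
    hence "coeff p k \<noteq> 0" using v by (simp add: cf)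
    hence "p \<noteq> 0" by auto
    moreover have "coeff p k \<in> \<rat>" for k by (simp add: cf)
    ultimately show ?thesis using u by (intro algebraicI') auto
  qed
qed

lemma algebraic_power_in_span:
  fixes a :: complex
  assumes "algebraic a"
  obtains n where "n > 0" "a ^ n \<in> Qspace.span ((\<lambda>i. a ^ i) ` {..<n})"
proof -
  from assms obtain p where p: "\<And>i. coeff p i \<in> \<rat>" "p \<noteq> 0" "poly p a = 0"
    unfolding algebraic_altdef by blast
  define n where "n = degree p"
  have "\<forall>i. \<exists>r. coeff p i = of_rat r" using p(1) by (meson Rats_cases)
  then obtain c where c: "\<And>i. coeff p i = of_rat (c i)" by metis
  have lc: "of_rat (c n) \<noteq> (0 :: complex)" using p(2) c by (metis n_def leading_coeff_0_iff)
  have "n > 0"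
  proof (rule ccontr)
    assume "\<not> n > 0"
    then obtain c where "p = [:c:]" by (auto simp: n_def elim: degree_eq_zeroE)
    thus False using p(2,3) by simp
  qed
  have "0 = (\<Sum>i\<le>n. of_rat (c i) * a ^ i)"
    using p(3) by (simp add: poly_altdef n_def c)
  also have "\<dots> = (\<Sum>i<n. of_rat (c i) * a ^ i) + of_rat (c n) * a ^ n"
    by (simp add: lessThan_Suc_atMost[symmetric])
  finally have "a ^ n = (\<Sum>i<n. of_rat (c i) * a ^ i) / of_rat (- c n)"
    using lc by (simp add: of_rat_minus field_simps eq_neg_iff_add_eq_0)
  also have "\<dots> = (\<Sum>i<n. qscale (c i / - c n) (a ^ i))"
    by (simp add: sum_divide_distrib qscale_def of_rat_divide of_rat_minus sum_negf)
  also have "\<dots> \<in> Qspace.span ((\<lambda>i. a ^ i) ` {..<n})"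
    by (intro Qspace.span_scale Qspace.span_sum Qspace.span_base) auto
  finally show ?thesis using \<open>n > 0\<close> that by blast
qed

text \<open>The monomials \<open>a ^ i * b ^ j\<close> with \<open>i < n\<close>,
  \<open>j < m\<close> span a space stable under multiplication by \<open>a\<close> and by
  \<open>b\<close>: an exponent that reaches \<open>n\<close> or \<open>m\<close> is reduced by the
  relation for \<open>a ^ n\<close> or \<open>b ^ m\<close>. Hence the space is stable under
  \<open>a + b\<close> and \<open>a * b\<close> too.\<close>

lemma algebraic_add_mult:
  fixes a b :: complex
  assumes "algebraic a" "algebraic b"
  shows algebraic_add: "algebraic (a + b)" and algebraic_mult: "algebraic (a * b)"
proof -
  obtain n where n: "n > 0" "a ^ n \<in> Qspace.span ((\<lambda>i. a ^ i) ` {..<n})"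
    using algebraic_power_in_span assms by blast
  obtain m where m: "m > 0" "b ^ m \<in> Qspace.span ((\<lambda>i. b ^ i) ` {..<m})"
    using algebraic_power_in_span assms by blast
  define B where "B = (\<lambda>(i, j). a ^ i * b ^ j) ` ({..<n} \<times> {..<m})"
  have fin: "finite B" by (simp add: B_def)
  have base: "a ^ i * b ^ j \<in> Qspace.span B" if "i < n" "j < m" for i j
    by (rule Qspace.span_base) (use that in \<open>auto simp: B_def\<close>)
  have one: "1 \<in> Qspace.span B" using base[of 0 0] n m by simp
  have an: "v * b ^ j \<in> Qspace.span B" if "j < m" "v \<in> Qspace.span ((\<lambda>i. a ^ i) ` {..<n})" for j v
    using that(2)
  proof (induction rule: Qspace.span_induct_alt)
    case (step c u v)
    have "(qscale c u + v) * b ^ j = qscale c (u * b ^ j) + v * b ^ j"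
      by (simp add: qscale_def algebra_simps)
    thus ?case using step base that(1) by (auto intro!: Qspace.span_add Qspace.span_scale)
  qed (simp add: Qspace.span_zero)
  have bm: "a ^ i * v \<in> Qspace.span B" if "i < n" "v \<in> Qspace.span ((\<lambda>i. b ^ i) ` {..<m})" for i v
    using that(2)
  proof (induction rule: Qspace.span_induct_alt)
    case (step c u v)
    have "a ^ i * (qscale c u + v) = qscale c (a ^ i * u) + a ^ i * v"
      by (simp add: qscale_def algebra_simps)
    thus ?case using step base that(1) by (auto intro!: Qspace.span_add Qspace.span_scale)
  qed (simp add: Qspace.span_zero)
  have a: "a * v \<in> Qspace.span B" if "v \<in> B" for v
  proof -
    from that obtain i j where ij: "v = a ^ i * b ^ j" "i < n" "j < m" by (auto simp: B_def)
    hence "a ^ Suc i \<in> Qspace.span ((\<lambda>i. a ^ i) ` {..<n})"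
      using n by (cases "Suc i = n") (auto intro!: Qspace.span_base simp del: power_Suc)
    from an[OF ij(3) this] ij show ?thesis by (simp add: mult.assoc)
  qed
  have b: "b * v \<in> Qspace.span B" if "v \<in> B" for v
  proof -
    from that obtain i j where ij: "v = a ^ i * b ^ j" "i < n" "j < m" by (auto simp: B_def)
    hence "b ^ Suc j \<in> Qspace.span ((\<lambda>i. b ^ i) ` {..<m})"
      using m by (cases "Suc j = m") (auto intro!: Qspace.span_base simp del: power_Suc)
    from bm[OF ij(2) this] ij show ?thesis by (simp add: mult_ac)
  qed
  have a': "a * v \<in> Qspace.span B" if "v \<in> Qspace.span B" for v
    using that
  proof (induction rule: Qspace.span_induct_alt)
    case (step c u v)
    have "a * (qscale c u + v) = qscale c (a * u) + a * v" by (simp add: qscale_def algebra_simps)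
    thus ?case using step a by (auto intro!: Qspace.span_add Qspace.span_scale)
  qed (simp add: Qspace.span_zero)
  show "algebraic (a + b)"
    using a b by (intro algebraic_if_mult_closed_span[OF fin one])
      (auto simp: ring_distribs intro!: Qspace.span_add)
  show "algebraic (a * b)"
    using a' b by (intro algebraic_if_mult_closed_span[OF fin one]) (auto simp: mult.assoc)
qed

lemma algebraic_sum: "(\<And>i. i \<in> A \<Longrightarrow> algebraic (f i)) \<Longrightarrow> algebraic (\<Sum>i\<in>A. f i)"
  for f :: "'a \<Rightarrow> complex"
  by (induction A rule: infinite_finite_induct) (auto intro: algebraic_add)

lemma algebraic_of_nat: "algebraic (of_nat n :: complex)"
  by (rule rat_imp_algebraic) simp

lemma algebraic_divide: "algebraic x \<Longrightarrow> algebraic y \<Longrightarrow> algebraic (x / y)" for x y :: complex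
  by (simp add: divide_inverse algebraic_mult algebraic_inverse)

lemma algebraic_diff: "algebraic x \<Longrightarrow> algebraic y \<Longrightarrow> algebraic (x - y)" for x y :: complex
  using algebraic_add[of x "- y"] by simp

lemma poly_Qbar_mult: "p \<in> poly_Qbar \<Longrightarrow> q \<in> poly_Qbar \<Longrightarrow> p * q \<in> poly_Qbar"
  by (simp add: poly_Qbar_def coeff_mult algebraic_sum algebraic_mult)

lemma poly_Qbar_prod: "(\<And>i. i \<in> A \<Longrightarrow> f i \<in> poly_Qbar) \<Longrightarrow> prod f A \<in> poly_Qbar"
proof (induction A rule: infinite_finite_induct)
  case (insert x F)
  thus ?case by (simp add: poly_Qbar_mult)
qed (auto simp: poly_Qbar_def intro: rat_imp_algebraic)

section \<open>Conjugates and roots of algebraic numbers\<close>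

text \<open>A nonzero rational polynomial of least degree vanishing at \<open>x\<close> is
  irreducible. This lets the bound on conjugates in the definition of an E-function be applied to
  the coefficient itself.\<close>

lemma galois_conjugate_refl:
  assumes "algebraic x"
  shows "galois_conjugate x x"
proof -
  from assms obtain p where p: "\<And>i. coeff p i \<in> \<rat>" "p \<noteq> 0" "poly p x = 0"
    unfolding algebraic_altdef by blast
  define P where "P = (\<lambda>q :: rat poly. q \<noteq> 0 \<and> poly (map_poly of_rat q) x = 0)"
  obtain q0 where "p = map_poly of_rat q0" using p(1) by (erule_tac ratpolyE)
  hence "P q0" using p by (auto simp: P_def)
  then obtain q where q: "P q" "\<And>r. P r \<Longrightarrow> degree q \<le> degree r"
    using ex_has_least_nat[of P q0 degree] by blast
  have mp: "map_poly of_rat (a * b) = (map_poly of_rat a * map_poly of_rat b :: complex poly)"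
    for a b :: "rat poly"
    by (rule poly_eqI) (simp add: coeff_map_poly coeff_mult of_rat_sum of_rat_mult)
  have unit: "b dvd 1" if "q = a * b" "poly (map_poly of_rat a) x = 0" for a b
  proof -
    have nz: "a \<noteq> 0" "b \<noteq> 0" using that q(1) by (auto simp: P_def)
    hence "degree q \<le> degree a" using q(2)[of a] that by (simp add: P_def)
    hence "degree b = 0" using nz that by (simp add: degree_mult_eq)
    thus ?thesis using nz is_unit_iff_degree by blast
  qed
  have "irreducible q"
  proof (rule irreducibleI)
    show "q \<noteq> 0" using q by (simp add: P_def)
    show "\<not> q dvd 1"
    proof
      assume "q dvd 1"
      then obtain c where c: "q = [:c:]" by (auto simp: is_unit_poly_iff)
      have "c \<noteq> 0" using q(1) c by (auto simp: P_def)
      thus False using q(1) c by (simp add: P_def map_poly_pCons)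
    qed
    fix a b assume ab: "q = a * b"
    hence "poly (map_poly of_rat a) x = 0 \<or> poly (map_poly of_rat b) x = 0"
      using q(1) by (simp add: P_def mp)
    thus "a dvd 1 \<or> b dvd 1"
      using unit[OF ab] unit[of b a] ab by (auto simp: mult.commute)
  qed
  thus ?thesis using q(1) by (auto simp: galois_conjugate_def P_def)
qed

lemma algebraic_of_power:
  fixes x :: complex
  assumes "algebraic (x ^ m)" "m > 0"
  shows "algebraic x"
  by (rule algebraic_root[of "x ^ m" "monom 1 m"])
    (use assms in \<open>auto simp: poly_monom degree_monom_eq\<close>)

subsection \<open>Derivatives of entire functions away from the zeros\<close>

lemma max_modulus_cball:
  fixes f :: "complex \<Rightarrow> complex"
  assumes "f holomorphic_on UNIV" "\<And>z. norm (z - c) = r \<Longrightarrow> norm (f z) \<le> B" "norm (z - c) \<le> r" "r > 0"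
  shows "norm (f z) \<le> B"
proof (rule maximum_modulus_frontier[of f "cball c r"])
  show "f holomorphic_on interior (cball c r)"
    using assms(1) by (rule holomorphic_on_subset) auto
  show "continuous_on (closure (cball c r)) f"
    by (rule holomorphic_on_imp_continuous_on[OF holomorphic_on_subset[OF assms(1) subset_UNIV]])
  show "norm (f w) \<le> B" if "w \<in> frontier (cball c r)" for w
    using that assms(2)[of w] assms(4) by (simp add: dist_norm norm_minus_commute)
qed (use assms in \<open>auto simp: dist_norm norm_minus_commute\<close>)

text \<open>The map w / (2A - w) sends the half plane Re w < A into the unit disc and fixes 0, so
  Schwarz's lemma applies to its composition with the rescaled \<open>f\<close>.\<close>

lemma Borel_Caratheodory:
  fixes f :: "complex \<Rightarrow> complex"
  assumes hol: "f holomorphic_on ball 0 R" and f0: "f 0 = 0" and "R > 0"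
    and Re: "\<And>z. norm z < R \<Longrightarrow> Re (f z) < A" and z: "norm z \<le> R / 2"
  shows "norm (f z) \<le> 2 * A"
proof -
  have A: "A > 0" using Re[of 0] f0 \<open>R > 0\<close> by simp
  define \<phi> where "\<phi> = (\<lambda>z. f (of_real R * z) / (of_real (2 * A) - f (of_real R * z)))"
  have in_ball: "norm (of_real R * w) < R" if "norm w < 1" for w :: complex
    using that \<open>R > 0\<close> by (simp add: norm_mult)
  have lt: "norm (f w) < norm (of_real (2 * A) - f w)" if "norm w < R" for w
  proof (rule power2_less_imp_less)
    have "(norm (f w))\<^sup>2 < (norm (f w))\<^sup>2 + 4 * A * (A - Re (f w))"
      using A Re[OF that] by simp
    also have "\<dots> = (norm (of_real (2 * A) - f w))\<^sup>2"
      unfolding cmod_power2 by (simp add: power2_eq_square algebra_simps)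
    finally show "(norm (f w))\<^sup>2 < (norm (of_real (2 * A) - f w))\<^sup>2" .
  qed simp
  have nz: "of_real (2 * A) - f w \<noteq> 0" if "norm w < R" for w
    using lt[OF that] by (metis norm_zero norm_not_less_zero)
  have "\<phi> holomorphic_on ball 0 1"
    unfolding \<phi>_def
  proof (intro holomorphic_intros)
    have "(f \<circ> (\<lambda>z. of_real R * z)) holomorphic_on ball 0 1"
      by (intro holomorphic_on_compose_gen[OF _ hol] holomorphic_intros)
         (use in_ball in auto)
    thus "(\<lambda>z. f (of_real R * z)) holomorphic_on ball 0 1"
      "(\<lambda>z. f (of_real R * z)) holomorphic_on ball 0 1" by (simp_all add: o_def)
  qed (use nz in_ball in auto)
  moreover have "\<phi> 0 = 0" by (simp add: \<phi>_def f0)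
  moreover have "norm (\<phi> w) < 1" if "norm w < 1" for w
    using lt[OF in_ball[OF that]] nz[OF in_ball[OF that]] by (simp add: \<phi>_def norm_divide)
  moreover have "norm (z / of_real R) < 1" using z \<open>R > 0\<close> by (simp add: norm_divide)
  ultimately have "norm (\<phi> (z / of_real R)) \<le> norm (z / of_real R)"
    by (rule Schwarz_Lemma(1))
  also have "\<dots> \<le> 1 / 2" using z \<open>R > 0\<close> by (simp add: norm_divide field_simps)
  finally have "norm (f z / (of_real (2 * A) - f z)) \<le> 1 / 2"
    using \<open>R > 0\<close> by (simp add: \<phi>_def)
  moreover have "of_real (2 * A) - f z \<noteq> 0" using z \<open>R > 0\<close> by (intro nz) auto
  ultimately have "2 * norm (f z) \<le> norm (of_real (2 * A) - f z)"
    by (simp add: norm_divide field_simps)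
  also have "\<dots> \<le> 2 * A + norm (f z)"
    using norm_triangle_ineq4[of "of_real (2 * A)" "f z"] A by (simp add: norm_mult)
  finally show ?thesis by simp
qed

text \<open>A disc of radius \<open>R / 4\<close> around a point of modulus at most
  \<open>R / 4\<close> stays where \<open>f\<close> is bounded by \<open>B\<close>. Cauchy's
  inequality there bounds the derivative, and the smaller disc is convex.\<close>

lemma norm_diff_le_of_norm_bound:
  fixes f :: "complex \<Rightarrow> complex"
  assumes hol: "f holomorphic_on ball 0 R" and bd: "\<And>z. norm z \<le> R / 2 \<Longrightarrow> norm (f z) \<le> B"
    and "R > 0" "norm z \<le> R / 4" "norm w \<le> R / 4"
  shows "norm (f w - f z) \<le> 4 * B / R * norm (w - z)"
proof (rule field_differentiable_bound[of "cball 0 (R / 4)" f "deriv f"])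
  fix u :: complex assume u: "u \<in> cball 0 (R / 4)"
  have sub: "norm v \<le> R / 2" if "norm (u - v) \<le> R / 4" for v
    using u norm_triangle_ineq4[of u "u - v"] that by simp
  have sub': "cball u (R / 4) \<subseteq> ball 0 R"
  proof
    fix v assume "v \<in> cball u (R / 4)"
    thus "v \<in> ball 0 R" using sub[of v] \<open>R > 0\<close> by (simp add: dist_norm)
  qed
  show "(f has_field_derivative deriv f u) (at u within cball 0 (R / 4))"
    by (rule has_field_derivative_at_within, rule holomorphic_derivI[OF hol])
      (use u \<open>R > 0\<close> in auto)
  have "norm ((deriv ^^ 1) f u) \<le> fact 1 * B / (R / 4) ^ 1"
  proof (rule Cauchy_inequality)
    show "f holomorphic_on ball u (R / 4)"
      using hol by (rule holomorphic_on_subset) (rule order_trans[OF ball_subset_cball sub'])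
    show "continuous_on (cball u (R / 4)) f"
      by (rule holomorphic_on_imp_continuous_on[OF holomorphic_on_subset[OF hol sub']])
    show "norm (f x) \<le> B" if "norm (u - x) = R / 4" for x
      using that by (intro bd sub) simp
  qed (use \<open>R > 0\<close> in simp)
  thus "norm (deriv f u) \<le> 4 * B / R" by (simp add: field_simps)
qed (use assms in auto)

section \<open>Zeros in a disc, counted with multiplicity\<close>

definition zero_factor :: "complex multiset \<Rightarrow> complex \<Rightarrow> complex" where
  "zero_factor A z = (\<Prod>a\<in>#A. z - a)"

text \<open>A substitute for Jensen's formula. Each linear factor has modulus at least
  \<open>2 * R\<close> on the circle of radius \<open>3 * R\<close>, but at most \<open>R\<close> at
  0. The maximum principle for \<open>G\<close> turns this gap into a factor 2 per zero.\<close>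

lemma zero_factor_bound:
  fixes g G :: "complex \<Rightarrow> complex"
  assumes G: "G holomorphic_on UNIV" and g: "\<And>z. g z = zero_factor A z * G z"
    and A: "\<And>a. a \<in># A \<Longrightarrow> norm a \<le> R" and "R > 0"
    and bd: "\<And>z. norm z \<le> 3 * R \<Longrightarrow> norm (g z) \<le> M"
  shows "2 ^ size A * norm (g 0) \<le> M"
    and "norm z \<le> 3 * R \<Longrightarrow> norm (G z) * norm (g 0) \<le> M * norm (G 0)"
proof -
  have low: "(2 * R) ^ size A \<le> norm (zero_factor A z)" if "norm z = 3 * R" for z
    using A
  proof (induction A)
    case (add x A)
    have "2 * R \<le> norm (z - x)"
      using norm_triangle_ineq2[of z x] add.prems[of x] that by simp
    hence "(2 * R) * (2 * R) ^ size A \<le> norm (z - x) * norm (zero_factor A z)"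
      using add \<open>R > 0\<close> by (intro mult_mono) auto
    thus ?case by (simp add: zero_factor_def norm_mult)
  qed (simp add: zero_factor_def)
  have up: "norm (zero_factor A 0) \<le> R ^ size A"
    using A
  proof (induction A)
    case (add x A)
    have "norm x * norm (zero_factor A 0) \<le> R * R ^ size A"
      using add \<open>R > 0\<close> by (intro mult_mono) auto
    thus ?case by (simp add: zero_factor_def norm_mult)
  qed (simp add: zero_factor_def)
  have *: "norm (G z) \<le> M / (2 * R) ^ size A" if "norm z \<le> 3 * R" for z
  proof (rule max_modulus_cball[OF G, where c = 0 and r = "3 * R"])
    fix w :: complex assume w: "norm (w - 0) = 3 * R"
    have "(2 * R) ^ size A * norm (G w) \<le> norm (zero_factor A w) * norm (G w)"
      using low[of w] w by (intro mult_right_mono) auto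
    also have "\<dots> \<le> M" using bd[of w] w g[of w] by (simp add: norm_mult)
    finally show "norm (G w) \<le> M / (2 * R) ^ size A" using \<open>R > 0\<close> by (simp add: field_simps)
  qed (use that \<open>R > 0\<close> in auto)
  have g0: "norm (g 0) \<le> R ^ size A * norm (G 0)"
    using up by (simp add: g norm_mult mult_right_mono)
  also have "\<dots> \<le> R ^ size A * (M / (2 * R) ^ size A)"
    using *[of 0] \<open>R > 0\<close> by (intro mult_left_mono) auto
  finally show "2 ^ size A * norm (g 0) \<le> M"
    using \<open>R > 0\<close> by (simp add: power_mult_distrib field_simps)
  have M: "M \<ge> 0" using order_trans[OF norm_ge_zero bd[of 0]] \<open>R > 0\<close> by simp
  assume z: "norm z \<le> 3 * R"
  have "norm (G z) * norm (g 0) \<le> M / (2 * R) ^ size A * (R ^ size A * norm (G 0))"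
    using *[OF z] g0 M \<open>R > 0\<close> by (intro mult_mono) auto
  also have "\<dots> = M * norm (G 0) / 2 ^ size A"
    using \<open>R > 0\<close> by (simp add: power_mult_distrib field_simps)
  also have "\<dots> \<le> M * norm (G 0) / 1"
    using M by (intro divide_left_mono) auto
  finally show "norm (G z) * norm (g 0) \<le> M * norm (G 0)" by simp
qed

lemma zero_factor_split:
  assumes "G holomorphic_on UNIV" "G a = 0"
  obtains H where "H holomorphic_on UNIV" "\<And>z. G z = (z - a) * H z"
proof
  let ?H = "\<lambda>z. if z = a then deriv G a else (G z - G a) / (z - a)"
  show "?H holomorphic_on UNIV" using assms by (intro pole_lemma) auto
  show "G z = (z - a) * ?H z" for z using assms by auto
qed

text \<open>Dividing out zeros stops because the growth of \<open>g\<close> bounds their number.\<close>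

lemma zero_factor_exists:
  fixes g :: "complex \<Rightarrow> complex"
  assumes g: "g holomorphic_on UNIV" and "g 0 \<noteq> 0" "R > 0"
  obtains A G where "G holomorphic_on UNIV" "\<And>z. g z = zero_factor A z * G z"
    "\<And>a. a \<in># A \<Longrightarrow> norm a \<le> R" "\<And>z. norm z \<le> R \<Longrightarrow> G z \<noteq> 0"
proof -
  have "continuous_on (cball 0 (3 * R)) g"
    by (rule holomorphic_on_imp_continuous_on[OF holomorphic_on_subset[OF g subset_UNIV]])
  hence "bounded (g ` cball 0 (3 * R))"
    by (intro compact_imp_bounded compact_continuous_image) auto
  then obtain M where M: "norm (g z) \<le> M" if "norm z \<le> 3 * R" for z
    unfolding bounded_iff by (metis imageI mem_cball_0)
  define P where "P = (\<lambda>n. \<exists>A G. size A = n \<and> G holomorphic_on UNIV \<and>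
    (\<forall>z. g z = zero_factor A z * G z) \<and> (\<forall>a\<in>#A. norm a \<le> R))"
  obtain K where K: "M / norm (g 0) < 2 ^ K"
    using real_arch_pow[of 2] by auto
  have "P 0" using g by (auto simp: P_def zero_factor_def intro!: exI[of _ g])
  have "n \<le> K" if "P n" for n
  proof (rule ccontr)
    assume n: "\<not> n \<le> K"
    from that obtain A G where AG: "size A = n" "G holomorphic_on UNIV"
      "\<And>z. g z = zero_factor A z * G z" "\<And>a. a \<in># A \<Longrightarrow> norm a \<le> R" by (auto simp: P_def)
    have "2 ^ n * norm (g 0) \<le> M"
      using zero_factor_bound(1)[OF AG(2-4) \<open>R > 0\<close> M] AG(1) by simp
    moreover have "(2 :: real) ^ K \<le> 2 ^ n" using n by (intro power_increasing) auto
    moreover have "M < 2 ^ K * norm (g 0)" using K \<open>g 0 \<noteq> 0\<close> by (simp add: divide_less_eq)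
    ultimately show False by (smt (verit) mult_right_mono norm_ge_zero)
  qed
  note bound = this
  \<comment> \<open>With as many zeros divided out as possible, a remaining zero of \<open>G\<close>
    in the disc could be split off as well, against maximality.\<close>
  define n where "n = (GREATEST n. P n)"
  have n: "P n" "\<And>k. P k \<Longrightarrow> k \<le> n"
    unfolding n_def by (rule GreatestI_nat[of P, OF \<open>P 0\<close> bound], assumption)
      (rule Greatest_le_nat[of P, OF _ bound])
  from n(1) obtain A G where AG: "size A = n" "G holomorphic_on UNIV"
    "\<And>z. g z = zero_factor A z * G z" "\<And>a. a \<in># A \<Longrightarrow> norm a \<le> R" by (auto simp: P_def)
  have "G z \<noteq> 0" if "norm z \<le> R" for z
  proof
    assume "G z = 0"
    then obtain H where H: "H holomorphic_on UNIV" "\<And>w. G w = (w - z) * H w"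
      using AG(2) zero_factor_split by blast
    have "P (Suc n)" unfolding P_def
      by (rule exI[of _ "add_mset z A"], rule exI[of _ H])
         (use AG H that in \<open>auto simp: zero_factor_def mult_ac\<close>)
    thus False using n(2) by fastforce
  qed
  thus ?thesis using AG that by blast
qed

text \<open>Factor by factor: moving from \<open>z\<close> to \<open>w\<close> adds at most
  \<open>d\<close>, and \<open>d <= (d / e) * norm (z - a)\<close>. If \<open>d / e\<close> is at
  most the inverse of the number of zeros, the product stays bounded however many zeros there
  are.\<close>

lemma zero_factor_ratio:
  assumes "\<And>a. a \<in># A \<Longrightarrow> e \<le> norm (z - a)" "e > 0" "norm (w - z) \<le> d"
  shows "norm (zero_factor A w) \<le> (1 + d / e) ^ size A * norm (zero_factor A z)"
  using assms(1)
proof (induction A)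
  case (add x A)
  have d: "d \<ge> 0" using assms(3) norm_ge_zero order_trans by blast
  have e: "e \<le> norm (z - x)" using add.prems by simp
  have "norm (w - x) \<le> norm (w - z) + norm (z - x)"
    using norm_triangle_ineq[of "w - z" "z - x"] by simp
  also have "\<dots> \<le> d * (norm (z - x) / e) + norm (z - x)"
  proof -
    have "d * 1 \<le> d * (norm (z - x) / e)"
      using e d \<open>e > 0\<close> by (intro mult_left_mono) auto
    thus ?thesis using assms(3) by simp
  qed
  also have "\<dots> = (1 + d / e) * norm (z - x)" by (simp add: algebra_simps)
  finally have "norm (w - x) * norm (zero_factor A w) \<le>
      ((1 + d / e) * norm (z - x)) * ((1 + d / e) ^ size A * norm (zero_factor A z))"
    using add d \<open>e > 0\<close> by (intro mult_mono) auto
  thus ?case by (simp add: zero_factor_def norm_mult mult_ac)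
qed (simp add: zero_factor_def)

text \<open>Pigeonhole: the spacing exceeds \<open>2 * e\<close>, so an element of \<open>S\<close>
  is closer than \<open>e\<close> to at most one of the \<open>N + 1\<close> grid points.\<close>

lemma grid_point_avoiding:
  fixes S :: "real set"
  assumes "finite S" "card S \<le> N" "2 * e < d"
  obtains i where "i \<le> N" "\<And>a. a \<in> S \<Longrightarrow> e \<le> \<bar>a - (c + real i * d)\<bar>"
proof (rule ccontr)
  assume contra: "\<not> thesis"
  note avoid = that
  have "\<exists>a\<in>S. \<bar>a - (c + real i * d)\<bar> < e" if "i \<le> N" for i
    using contra avoid[OF that] by (meson not_le)
  then obtain f where f: "\<And>i. i \<le> N \<Longrightarrow> f i \<in> S \<and> \<bar>f i - (c + real i * d)\<bar> < e"
    by metis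
  have e: "e > 0" using f[of 0] by linarith
  have "inj_on f {..N}"
  proof (rule linorder_inj_onI)
    fix i j :: nat assume ij: "i < j" "i \<in> {..N}" "j \<in> {..N}"
    have "1 * d \<le> real (j - i) * d" using ij e assms by (intro mult_right_mono) auto
    hence "d \<le> real j * d - real i * d" using ij by (simp add: of_nat_diff algebra_simps)
    thus "f i \<noteq> f j" using f[of i] f[of j] ij assms(3) by auto
  qed auto
  hence "card {..N} \<le> card S"
    using f assms(1) by (intro card_inj_on_le) auto
  thus False using assms(2) by simp
qed

lemma card_set_mset_le_size: "card (set_mset A) \<le> size A"
  by (induction A) (auto simp: card_insert_if)

text \<open>
  Write \<open>g = zero_factor A \<sqdot> G\<close> with \<open>G\<close> free of zeros in \<open>\<bar>z\<bar> \<le> R\<close>. By the Borel-Caratheodory inequality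
  \<open>log G\<close> varies slowly, and a circle \<open>\<bar>z\<bar> = r\<close> can be chosen away from the zeros, so \<open>g\<close> changes at
  most by a factor 9 on discs of radius \<open>\<delta> = R / (48 B\<^sup>2)\<close> around its points. Cauchy's inequality on
  these discs gives the claim. The number \<open>B\<close> bounds both the number of zeros and \<open>Re (log G)\<close>.
\<close>

proposition higher_deriv_quotient_bound:
  fixes g :: "complex \<Rightarrow> complex"
  assumes g: "g holomorphic_on UNIV" and g0: "g 0 \<noteq> 0" and R: "R > 0"
    and bd: "\<And>z. norm z \<le> 3 * R \<Longrightarrow> norm (g z) \<le> M"
    and B: "B = 2 + 2 * ln (M / norm (g 0))"
  obtains r where "R / 16 \<le> r" "r \<le> R / 8" "\<And>z. norm z = r \<Longrightarrow> g z \<noteq> 0"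
    "\<And>z k. norm z = r \<Longrightarrow>
       norm ((deriv ^^ k) g z) \<le> 9 * fact k * (48 * B\<^sup>2 / R) ^ k * norm (g z)"
proof -
  obtain G A where G: "G holomorphic_on UNIV" and gAG: "\<And>z. g z = zero_factor A z * G z"
    and A: "\<And>a. a \<in># A \<Longrightarrow> norm a \<le> R" and Gnz: "\<And>z. norm z \<le> R \<Longrightarrow> G z \<noteq> 0"
    by (rule zero_factor_exists[OF g g0 R], rule that)
  define N where "N = size A"
  define \<Lambda> where "\<Lambda> = ln (M / norm (g 0))"
  have Mg: "norm (g 0) \<le> M" using bd[of 0] R by simp
  have M: "M > 0" using Mg g0 by (smt (verit) zero_less_norm_iff)
  have \<Lambda>: "\<Lambda> \<ge> 0" unfolding \<Lambda>_def using Mg g0 M by (intro ln_ge_zero) (simp add: field_simps)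
  have B': "B = 2 + 2 * \<Lambda>" by (simp add: B \<Lambda>_def)
  have "2 ^ N \<le> M / norm (g 0)"
    using zero_factor_bound(1)[OF G gAG A R bd] g0 by (simp add: N_def field_simps)
  hence "ln (2 ^ N) \<le> \<Lambda>" unfolding \<Lambda>_def using M g0 by (subst ln_le_cancel_iff) auto
  hence N1: "real N * ln 2 \<le> \<Lambda>" by (simp add: ln_realpow)
  \<comment> \<open>As ln 2 is at least 1/2, there are at most 2 \<Lambda> zeros; this is the origin
    of the form of \<open>B\<close>.\<close>
  have "real N * (1 / 2) \<le> real N * ln 2" using ln2_ge_two_thirds by (intro mult_left_mono) auto
  with N1 have NB: "real N + 1 \<le> B" using B' by simp

  obtain H where H: "H holomorphic_on ball 0 R" "\<And>z. z \<in> ball 0 R \<Longrightarrow> G z = exp (H z)"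
  proof (rule contractible_imp_holomorphic_log)
    show "G holomorphic_on ball 0 R" using G by (rule holomorphic_on_subset) simp
    show "contractible (ball 0 R :: complex set)" by (simp add: convex_imp_contractible)
  qed (use Gnz in auto)
  \<comment> \<open>A logarithm of \<open>G / G 0\<close>, normalized to vanish at 0 as the
    Borel-Caratheodory inequality requires.\<close>
  define f where "f = (\<lambda>z. H z - H 0)"
  have f: "f holomorphic_on ball 0 R" unfolding f_def by (intro holomorphic_intros H)
  have Gf: "G z = G 0 * exp (f z)" if "norm z < R" for z
    using H(2)[of z] H(2)[of 0] that R by (simp add: f_def exp_diff)
  \<comment> \<open>The added 1 provides the strict inequality on the real part.\<close>
  have f1: "norm (f z) \<le> 2 * (\<Lambda> + 1)" if "norm z \<le> R / 2" for z
  proof (rule Borel_Caratheodory[OF f _ R _ that])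
    fix z :: complex assume z: "norm z < R"
    have "norm (G z) * norm (g 0) \<le> M * norm (G 0)"
      using zero_factor_bound(2)[OF G gAG A R bd, of z] z R by simp
    hence "exp (Re (f z)) * norm (g 0) \<le> M"
      using Gnz[of 0] R Gf[OF z] by (simp add: norm_mult mult_ac)
    hence "exp (Re (f z)) \<le> M / norm (g 0)" using g0 by (simp add: field_simps)
    also have "\<dots> = exp \<Lambda>" using M g0 by (simp add: \<Lambda>_def)
    finally show "Re (f z) < \<Lambda> + 1" by simp
  qed (simp add: f_def)
  have f2B: "norm (f z) \<le> 2 * B" if "norm z \<le> R / 2" for z
    using f1[OF that] B' \<Lambda> by simp
  have B2: "B \<ge> 2" using B' \<Lambda> by simp
  \<comment> \<open>The grid below has at most \<open>N\<close> steps of length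
    \<open>3 * (N + 1) * \<delta>\<close>, in total at most 3 B^2 \<delta> = R / 16. So 48 = 3 * 16
    keeps the radius between \<open>R / 16\<close> and \<open>R / 8\<close>.\<close>
  define \<delta> where "\<delta> = R / (48 * B\<^sup>2)"
  have \<delta>0: "\<delta> > 0" using R B2 by (simp add: \<delta>_def)
  have "1 * 1 \<le> B * B" using B2 by (intro mult_mono) auto
  hence \<delta>1: "\<delta> \<le> R / 48" using R B2
    by (simp add: \<delta>_def field_simps power2_eq_square)
  have \<delta>2: "8 * B / R * \<delta> \<le> 1"
    using R B2 by (simp add: \<delta>_def field_simps power2_eq_square)
  have card: "card (norm ` set_mset A) \<le> N"
    unfolding N_def
    by (rule order_trans[OF card_image_le[OF finite_set_mset] card_set_mset_le_size])
  \<comment> \<open>It suffices to avoid the moduli of the zeros, since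
    \<open>\<bar>norm a - norm z\<bar> <= norm (a - z)\<close>.\<close>
  obtain i where i: "i \<le> N"
    "\<And>a. a \<in> norm ` set_mset A \<Longrightarrow> (real N + 1) * \<delta> \<le> \<bar>a - (R / 16 + real i * (3 * (real N + 1) * \<delta>))\<bar>"
    using grid_point_avoiding[of "norm ` set_mset A" N "(real N + 1) * \<delta>"
      "3 * (real N + 1) * \<delta>" "R / 16"] card \<delta>0 by auto
  define r where "r = R / 16 + real i * (3 * (real N + 1) * \<delta>)"
  have "real i * (real N + 1) \<le> B * B" using i(1) NB by (intro mult_mono) auto
  hence "real i * (real N + 1) * (3 * \<delta>) \<le> B * B * (3 * \<delta>)"
    using \<delta>0 by (intro mult_right_mono) auto
  also have "\<dots> = R / 16" using B2 by (simp add: \<delta>_def power2_eq_square)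
  also have "real i * (real N + 1) * (3 * \<delta>) = real i * (3 * (real N + 1) * \<delta>)" by simp
  finally have r2: "r \<le> R / 8" unfolding r_def by linarith
  have r1: "R / 16 \<le> r" using \<delta>0 by (simp add: r_def)
  have ratio: "norm (g w) \<le> 9 * norm (g z)" "g z \<noteq> 0" if z: "norm z = r" and w: "norm (w - z) \<le> \<delta>" for z w
  proof -
    have dist: "(real N + 1) * \<delta> \<le> norm (z - a)" if "a \<in># A" for a
    proof -
      have "(real N + 1) * \<delta> \<le> \<bar>norm a - norm z\<bar>" using i(2)[of "norm a"] that z by (simp add: r_def)
      also have "\<dots> \<le> norm (a - z)" by (rule norm_triangle_ineq3)
      finally show ?thesis by (simp add: norm_minus_commute)
    qed
    have pos: "(real N + 1) * \<delta> > 0" using \<delta>0 by simp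
    have "zero_factor A z \<noteq> 0"
    proof
      assume "zero_factor A z = 0"
      hence "z \<in># A" by (auto simp: zero_factor_def)
      from dist[OF this] pos show False by simp
    qed
    thus "g z \<noteq> 0" using Gnz[of z] r2 z R gAG by simp
    have zR: "norm z \<le> R / 4" "norm w \<le> R / 4" "norm z < R" "norm w < R"
      using z r2 \<delta>1 w R norm_triangle_ineq[of z "w - z"] by simp_all
    \<comment> \<open>The zeros contribute at most (1 + 1/(N+1))^N <= e <= 3. The zero-free part
      contributes another factor 3, because \<open>f\<close> varies by at most 1. Together they give
      the 9.\<close>
    have "\<delta> / ((real N + 1) * \<delta>) = 1 / (real N + 1)" using \<delta>0 by simp
    hence "norm (zero_factor A w) \<le> (1 + 1 / (real N + 1)) ^ N * norm (zero_factor A z)"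
      using zero_factor_ratio[OF dist pos w] by (simp only: N_def)
    also have "(1 + 1 / (real N + 1)) ^ N \<le> exp (1 / (real N + 1)) ^ N"
      using exp_ge_add_one_self[of "1 / (real N + 1)"] by (intro power_mono) simp_all
    also have "exp (1 / (real N + 1)) ^ N = exp (real N * (1 / (real N + 1)))"
      by (simp only: exp_of_nat_mult)
    also have "\<dots> \<le> exp 1" by simp
    also have "exp 1 \<le> (3 :: real)" by (rule exp_le)
    finally have 1: "norm (zero_factor A w) \<le> 3 * norm (zero_factor A z)" by (simp add: mult_right_mono)
    have "norm (f w - f z) \<le> 4 * (2 * B) / R * norm (w - z)"
      by (rule norm_diff_le_of_norm_bound[OF f f2B R zR(1,2)])
    also have "\<dots> \<le> 4 * (2 * B) / R * \<delta>" using w B2 R by (intro mult_left_mono) auto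
    also have "\<dots> \<le> 1" using \<delta>2 by simp
    finally have "Re (f w - f z) \<le> 1" using complex_Re_le_cmod order_trans by blast
    hence "exp (Re (f w - f z)) \<le> exp 1" by simp
    also have "\<dots> \<le> (3 :: real)" by (rule exp_le)
    finally have "norm (G z) * norm (exp (f w - f z)) \<le> norm (G z) * 3"
      by (intro mult_left_mono) simp_all
    moreover have "G w = G z * exp (f w - f z)" using Gf[OF zR(3)] Gf[OF zR(4)] by (simp add: exp_diff)
    ultimately have 2: "norm (G w) \<le> 3 * norm (G z)" by (simp add: norm_mult)
    have "norm (g w) \<le> (3 * norm (zero_factor A z)) * (3 * norm (G z))"
      unfolding gAG norm_mult by (intro mult_mono 1 2) auto
    thus "norm (g w) \<le> 9 * norm (g z)" by (simp add: gAG norm_mult)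
  qed
  show thesis
  proof
    show "g z \<noteq> 0" if "norm z = r" for z using ratio(2)[OF that, of z] \<delta>0 by simp
    fix z :: complex and k assume z: "norm z = r"
    have "norm ((deriv ^^ k) g z) \<le> fact k * (9 * norm (g z)) / \<delta> ^ k"
    proof (rule Cauchy_inequality)
      show "g holomorphic_on ball z \<delta>" using g by (rule holomorphic_on_subset) simp
      show "continuous_on (cball z \<delta>) g"
        by (rule holomorphic_on_imp_continuous_on[OF holomorphic_on_subset[OF g subset_UNIV]])
      show "norm (g x) \<le> 9 * norm (g z)" if "norm (z - x) = \<delta>" for x
        using ratio(1)[OF z, of x] that by (simp add: norm_minus_commute)
    qed (rule \<delta>0)
    also have "\<dots> = 9 * fact k * (48 * B\<^sup>2 / R) ^ k * norm (g z)"
      by (simp add: \<delta>_def power_divide)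
    finally show "norm ((deriv ^^ k) g z) \<le> 9 * fact k * (48 * B\<^sup>2 / R) ^ k * norm (g z)" .
  qed (rule r1, rule r2)
qed

subsection \<open>Growth\<close>

text \<open>The coefficients a_n are bounded by C^(n+1), so the series is dominated by
  \<open>C\<close> times the exponential series at \<open>C * norm z\<close>.\<close>

lemma E_function_exponential_type:
  assumes f: "f holomorphic_on UNIV" and E: "E_function (fps_expansion f 0)"
  obtains C where "C > 0" "\<And>z. norm (f z) \<le> C * exp (C * norm z)"
proof -
  define F where "F = fps_expansion f 0"
  have alg: "\<And>n. algebraic (egf_coeff F n)"
    using E unfolding E_function_def F_def by blast
  have "\<exists>C>0. \<forall>n y. galois_conjugate (egf_coeff F n) y \<longrightarrow> norm y \<le> C ^ (n + 1)"
    using E unfolding E_function_def F_def by blast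
  then obtain C where C: "C > 0"
    "\<And>n y. galois_conjugate (egf_coeff F n) y \<Longrightarrow> norm y \<le> C ^ (n + 1)"
    by metis
  have coeff: "norm (egf_coeff F n) \<le> C ^ (n + 1)" for n
    by (rule C(2)[OF galois_conjugate_refl[OF alg]])
  show thesis
  proof
    fix z :: complex
    have "(\<lambda>n. (deriv ^^ n) f 0 / fact n * (z - 0) ^ n) sums f z"
    proof (rule holomorphic_power_series)
      show "f holomorphic_on ball 0 (norm z + 1)" using f by (rule holomorphic_on_subset) simp
    qed simp
    moreover have "(\<lambda>n. C * ((C * norm z) ^ n / fact n)) sums (C * exp (C * norm z))"
      using exp_converges[of "C * norm z"] by (intro sums_mult) (simp add: field_simps)
    moreover have "norm ((deriv ^^ n) f 0 / fact n * (z - 0) ^ n) \<le> C * ((C * norm z) ^ n / fact n)" for n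
    proof -
      have "norm ((deriv ^^ n) f 0) \<le> C ^ (n + 1)"
        using coeff[of n] by (simp add: egf_coeff_def F_def fps_expansion_def)
      hence "norm ((deriv ^^ n) f 0) * (norm z ^ n / fact n) \<le> C ^ (n + 1) * (norm z ^ n / fact n)"
        by (intro mult_right_mono) auto
      thus ?thesis by (simp add: norm_mult norm_divide norm_power power_mult_distrib)
    qed
    ultimately show "norm (f z) \<le> C * exp (C * norm z)" by (rule norm_sums_le)
  qed (rule C(1))
qed

text \<open>Uses t <= 1 + t^m for t >= 0 in place of an m-th root.\<close>

lemma exponential_type_of_power:
  fixes g :: "complex \<Rightarrow> complex"
  assumes "C > 0" "\<And>z. norm (g z ^ m) \<le> C * exp (C * norm z)" "m \<ge> 1"
  shows "norm (g z) \<le> (1 + C) * exp (C * norm z)"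
proof -
  have "norm (g z) \<le> 1 + norm (g z) ^ m"
  proof (cases "norm (g z) \<le> 1")
    case True
    thus ?thesis by (smt (verit) norm_ge_zero zero_le_power)
  next
    case False
    hence "norm (g z) ^ 1 \<le> norm (g z) ^ m" using assms(3) by (intro power_increasing) auto
    thus ?thesis by simp
  qed
  also have "\<dots> \<le> 1 * exp (C * norm z) + C * exp (C * norm z)"
    using assms(1) assms(2)[of z] by (intro add_mono) (auto simp: norm_power)
  finally show ?thesis by (simp add: ring_distribs)
qed

section \<open>From exponential type of \<open>g\<close> to polynomial growth of
  \<open>h\<close>\<close>

lemma poly_growth:
  fixes p :: "nat \<Rightarrow> complex poly"
  obtains c k where "c > 0" "\<And>z. (\<Sum>i\<le>n. norm (poly (p i) z)) \<le> c * (1 + norm z) ^ k"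
proof -
  have single: "\<exists>c k. c \<ge> 0 \<and> (\<forall>z. norm (poly q z) \<le> c * (1 + norm z) ^ k)" for q :: "complex poly"
  proof (intro exI conjI allI)
    show "(\<Sum>i\<le>degree q. norm (coeff q i)) \<ge> 0" by (intro sum_nonneg) auto
    fix z :: complex
    have "norm (poly q z) \<le> (\<Sum>i\<le>degree q. norm (coeff q i * z ^ i))"
      unfolding poly_altdef by (rule norm_sum)
    also have "\<dots> \<le> (\<Sum>i\<le>degree q. norm (coeff q i) * (1 + norm z) ^ degree q)"
    proof (intro sum_mono)
      fix i assume i: "i \<in> {..degree q}"
      have "norm z ^ i \<le> (1 + norm z) ^ i" by (intro power_mono) auto
      also have "\<dots> \<le> (1 + norm z) ^ degree q" using i by (intro power_increasing) auto
      finally show "norm (coeff q i * z ^ i) \<le> norm (coeff q i) * (1 + norm z) ^ degree q"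
        by (simp add: norm_mult norm_power mult_left_mono)
    qed
    finally show "norm (poly q z) \<le> (\<Sum>i\<le>degree q. norm (coeff q i)) * (1 + norm z) ^ degree q"
      by (simp add: sum_distrib_right)
  qed
  have "\<exists>c k. c \<ge> 0 \<and> (\<forall>z. (\<Sum>i\<le>n. norm (poly (p i) z)) \<le> c * (1 + norm z) ^ k)"
  proof (induction n)
    case 0
    show ?case using single[of "p 0"] by simp
  next
    case (Suc n)
    then obtain c k where ck: "c \<ge> 0" "\<And>z. (\<Sum>i\<le>n. norm (poly (p i) z)) \<le> c * (1 + norm z) ^ k"
      by blast
    obtain c' k' where ck': "c' \<ge> 0" "\<And>z. norm (poly (p (Suc n)) z) \<le> c' * (1 + norm z) ^ k'"
      using single by blast
    show ?case
    proof (intro exI conjI allI)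
      show "c + c' \<ge> 0" using ck ck' by simp
      fix z :: complex
      have "(\<Sum>i\<le>Suc n. norm (poly (p i) z)) \<le> c * (1 + norm z) ^ k + c' * (1 + norm z) ^ k'"
        using ck(2)[of z] ck'(2)[of z] by simp
      also have "\<dots> \<le> c * (1 + norm z) ^ (k + k') + c' * (1 + norm z) ^ (k + k')"
        using ck(1) ck'(1) by (intro add_mono mult_left_mono power_increasing) auto
      finally show "(\<Sum>i\<le>Suc n. norm (poly (p i) z)) \<le> (c + c') * (1 + norm z) ^ (k + k')"
        by (simp add: ring_distribs)
    qed
  qed
  then obtain c k where ck: "c \<ge> 0" "\<And>z. (\<Sum>i\<le>n. norm (poly (p i) z)) \<le> c * (1 + norm z) ^ k"
    by blast
  show thesis
  proof (rule that[of "c + 1" k])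
    fix z :: complex
    have "c * (1 + norm z) ^ k \<le> (c + 1) * (1 + norm z) ^ k" by (intro mult_right_mono) auto
    thus "(\<Sum>i\<le>n. norm (poly (p i) z)) \<le> (c + 1) * (1 + norm z) ^ k" using ck(2)[of z] by simp
  qed (use ck(1) in simp)
qed

lemma poly_bounded_below:
  fixes p :: "complex poly"
  assumes "p \<noteq> 0"
  obtains c r where "c > 0" "\<And>z. r \<le> norm z \<Longrightarrow> c \<le> norm (poly p z)"
proof (cases p)
  case (pCons a q)
  show thesis
  proof (cases "q = 0")
    case True
    thus thesis using pCons assms that[of "norm a" 0] by auto
  next
    case False
    from poly_infinity[OF this, of 1 a] show thesis using pCons that[of 1] by auto
  qed
qed

lemma higher_deriv_shift: "(deriv ^^ k) (\<lambda>w. g (a + w)) w = (deriv ^^ k) g (a + w :: complex)"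
proof -
  have "(deriv ^^ k) (\<lambda>w. g (a + w)) w = (deriv ^^ k) ((\<lambda>w. g (a + w)) \<circ> (\<lambda>x. w + x)) 0"
    by (rule higher_deriv_shift_0)
  also have "(\<lambda>w. g (a + w)) \<circ> (\<lambda>x. w + x) = g \<circ> (\<lambda>x. (a + w) + x)"
    by (simp add: o_def add_ac)
  also have "(deriv ^^ k) \<dots> 0 = (deriv ^^ k) g (a + w)"
    by (rule higher_deriv_shift_0[symmetric])
  finally show ?thesis .
qed

text \<open>For \<open>g\<close> of exponential type the quantity \<open>B\<close> of the previous
  proposition is O(R), so \<open>48 * B\<^sup>2 / R\<close> is O(R) as well. Recentring at
  \<open>z0\<close> provides the nonzero value at the centre.\<close>

proposition polynomial_growth_of_quotient:
  fixes g h :: "complex \<Rightarrow> complex" and p :: "nat \<Rightarrow> complex poly"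
  assumes g: "g holomorphic_on UNIV" and h: "h holomorphic_on UNIV"
    and z0: "g z0 \<noteq> 0" and C: "C > 0" "c > 0" "\<And>z. norm (g z) \<le> c * exp (C * norm z)"
    and D: "D \<noteq> 0"
    and eq: "\<And>z. poly D z * h z * g z = (\<Sum>i\<le>n. poly (p i) z * (deriv ^^ i) g z)"
  obtains A B k where "\<And>z. A \<le> norm z \<Longrightarrow> norm (h z) \<le> B * norm z ^ k"
proof -
  define g1 where "g1 = (\<lambda>w. g (z0 + w))"
  have g1: "g1 holomorphic_on UNIV"
    unfolding g1_def
    by (rule holomorphic_on_compose_gen[OF _ g, of "\<lambda>w. z0 + w" UNIV, unfolded o_def])
      (auto intro!: holomorphic_intros)
  have g10: "g1 0 \<noteq> 0" using z0 by (simp add: g1_def)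
  define c1 where "c1 = c * exp (C * norm z0)"
  have c1: "c1 > 0" using C by (simp add: c1_def)
  have g1_bound: "norm (g1 w) \<le> c1 * exp (C * (3 * R))" if "norm w \<le> 3 * R" for w R
  proof -
    have "norm (g1 w) \<le> c * exp (C * norm (z0 + w))" unfolding g1_def by (rule C(3))
    also have "\<dots> \<le> c * exp (C * (norm z0 + 3 * R))"
    proof -
      have "norm (z0 + w) \<le> norm z0 + 3 * R" using norm_triangle_ineq[of z0 w] that by simp
      thus ?thesis using C(1,2) by (intro mult_left_mono) simp_all
    qed
    finally show ?thesis by (simp add: c1_def exp_add ring_distribs mult_ac)
  qed
  \<comment> \<open>Chosen so that \<open>\<bar>B\<bar> <= b * R\<close> for all
    \<open>R >= 1\<close>. The 1 added in \<beta> gives \<open>1 <= \<beta> * R\<close>, so the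
    bound for order \<open>n\<close> covers all lower orders.\<close>
  define b where "b = 2 + 2 * \<bar>ln c1 - ln (norm (g1 0))\<bar> + 6 * C"
  define \<beta> where "\<beta> = 48 * b\<^sup>2 + 1"
  have \<beta>: "\<beta> \<ge> 1" by (simp add: \<beta>_def)
  obtain cp kp where cp: "cp > 0" "\<And>z. (\<Sum>i\<le>n. norm (poly (p i) z)) \<le> cp * (1 + norm z) ^ kp"
    by (rule poly_growth[of p n], rule that)
  obtain cD rD where cD: "cD > 0" "\<And>z. rD \<le> norm z \<Longrightarrow> cD \<le> norm (poly D z)"
    by (rule poly_bounded_below[OF D], rule that)
  define a where "a = 2 + norm z0"
  define Q where "Q = 9 * fact n * \<beta> ^ n * cp * a ^ kp / cD"
  have Q: "Q > 0" using \<beta> cp cD by (simp add: Q_def a_def add_pos_nonneg)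
  \<comment> \<open>The second condition on \<open>R\<close> puts the circle of radius at least
    \<open>R / 16\<close> around \<open>z0\<close> into the region where \<open>D\<close> is bounded
    below.\<close>
  have main: "norm (h z) \<le> Q * R ^ (kp + n)"
    if R: "R \<ge> 1" "R \<ge> 16 * (rD + norm z0)" and z: "norm (z - z0) \<le> R / 16" for z R
  proof -
    define B where "B = 2 + 2 * ln (c1 * exp (C * (3 * R)) / norm (g1 0))"
    have R0: "R > 0" using R by simp
    obtain r where r: "R / 16 \<le> r" "r \<le> R / 8" "\<And>z. norm z = r \<Longrightarrow> g1 z \<noteq> 0"
      "\<And>z k. norm z = r \<Longrightarrow>
        norm ((deriv ^^ k) g1 z) \<le> 9 * fact k * (48 * B\<^sup>2 / R) ^ k * norm (g1 z)"
      by (rule higher_deriv_quotient_bound[OF g1 g10 R0 g1_bound B_def], assumption, rule that)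
    have "B = 2 + 2 * (ln c1 - ln (norm (g1 0))) + 6 * C * R"
      using c1 g10 by (simp add: B_def ln_div ln_mult)
    moreover have "\<bar>2 + 2 * x + 6 * y\<bar> \<le> 2 + 2 * \<bar>x\<bar> + 6 * y" if "y > 0" for x y :: real
      using that by linarith
    ultimately have "\<bar>B\<bar> \<le> 2 + 2 * \<bar>ln c1 - ln (norm (g1 0))\<bar> + 6 * C * R"
      using mult_pos_pos[OF C(1) R0] by (simp only: mult.assoc)
    also have "\<dots> \<le> 2 * R + (2 * \<bar>ln c1 - ln (norm (g1 0))\<bar>) * R + 6 * C * R"
      using R(1) mult_left_mono[of 1 R "2 * \<bar>ln c1 - ln (norm (g1 0))\<bar>"] by simp
    also have "\<dots> = b * R" by (simp add: b_def ring_distribs)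
    finally have "\<bar>B\<bar>\<^sup>2 \<le> (b * R)\<^sup>2" by (intro power_mono) auto
    hence "48 * B\<^sup>2 / R \<le> 48 * b\<^sup>2 * R" using R0 by (simp add: field_simps power2_eq_square)
    also have "\<dots> \<le> \<beta> * R" using R0 by (intro mult_right_mono) (auto simp: \<beta>_def)
    finally have BR: "48 * B\<^sup>2 / R \<le> \<beta> * R" .
    have \<beta>R: "1 \<le> \<beta> * R" using mult_mono[of 1 \<beta> 1 R] \<beta> R by simp
    have deriv_bound: "norm ((deriv ^^ i) g (z0 + w)) \<le> 9 * fact n * (\<beta> * R) ^ n * norm (g (z0 + w))"
      if w: "norm w = r" and i: "i \<le> n" for w i
    proof -
      have "norm ((deriv ^^ i) g (z0 + w)) \<le> 9 * fact i * (48 * B\<^sup>2 / R) ^ i * norm (g (z0 + w))"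
        using r(4)[OF w, of i] by (simp add: g1_def higher_deriv_shift)
      also have "\<dots> \<le> 9 * fact n * (\<beta> * R) ^ n * norm (g (z0 + w))"
      proof (intro mult_mono)
        have "(48 * B\<^sup>2 / R) ^ i \<le> (\<beta> * R) ^ i" using BR R0 by (intro power_mono) auto
        also have "\<dots> \<le> (\<beta> * R) ^ n" using \<beta>R i by (intro power_increasing)
        finally show "(48 * B\<^sup>2 / R) ^ i \<le> (\<beta> * R) ^ n" .
      qed (use i \<beta> R0 in \<open>auto intro: fact_mono\<close>)
      finally show ?thesis .
    qed
    show ?thesis
    proof (rule max_modulus_cball[OF h])
      show "norm (z - z0) \<le> r" using z r by simp
      show "r > 0" using r R0 by simp
      fix v assume v: "norm (v - z0) = r"
      define w where "w = v - z0"
      have w: "norm w = r" "v = z0 + w" using v by (simp_all add: w_def)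
      have gv: "g v \<noteq> 0" using r(3)[OF w(1)] w(2) by (simp add: g1_def)
      have "norm v \<le> norm z0 + r" using norm_triangle_ineq[of z0 w] w by simp
      hence "1 + norm v \<le> a * R"
        using r(2) R mult_left_mono[of 1 R "norm z0"] by (simp add: a_def ring_distribs)
      hence 1: "(1 + norm v) ^ kp \<le> (a * R) ^ kp" by (intro power_mono) auto
      have "r \<le> norm v + norm z0" using norm_triangle_ineq4[of v z0] v by simp
      hence 2: "cD \<le> norm (poly D v)" using r(1) R(2) by (intro cD(2)) simp
      have "cD * norm (h v) * norm (g v) \<le> norm (poly D v * h v * g v)"
        using 2 by (simp add: norm_mult mult_right_mono)
      also have "\<dots> \<le> (\<Sum>i\<le>n. norm (poly (p i) v * (deriv ^^ i) g v))"
        unfolding eq by (rule norm_sum)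
      also have "\<dots> \<le> (\<Sum>i\<le>n. norm (poly (p i) v) * (9 * fact n * (\<beta> * R) ^ n * norm (g v)))"
        using deriv_bound[OF w(1)] w(2) by (intro sum_mono) (auto simp: norm_mult intro!: mult_left_mono)
      also have "\<dots> = (\<Sum>i\<le>n. norm (poly (p i) v)) * (9 * fact n * (\<beta> * R) ^ n * norm (g v))"
        by (rule sum_distrib_right[symmetric])
      also have "\<dots> \<le> (cp * (a * R) ^ kp) * (9 * fact n * (\<beta> * R) ^ n * norm (g v))"
        using order_trans[OF cp(2)[of v] mult_left_mono[OF 1, of cp]] cp(1) \<beta> R0
        by (intro mult_right_mono) auto
      also have "\<dots> = cD * (Q * R ^ (kp + n)) * norm (g v)"
        using cD(1) by (simp add: Q_def power_mult_distrib power_add)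
      finally show "norm (h v) \<le> Q * R ^ (kp + n)" using gv cD(1) by (simp add: mult.assoc)
    qed
  qed
  show thesis
  proof
    fix z :: complex assume z: "1 + norm z0 + \<bar>rD\<bar> \<le> norm z"
    \<comment> \<open>Since \<open>norm z0 <= norm z\<close>, the distance from \<open>z\<close> to
      \<open>z0\<close> is at most \<open>2 * norm z = R / 16\<close>.\<close>
    define R where "R = 32 * norm z"
    have "1 \<le> R" unfolding R_def using z norm_ge_zero[of z0] by linarith
    moreover have "16 * (rD + norm z0) \<le> R"
      unfolding R_def using z norm_ge_zero[of z0] norm_ge_zero[of z] abs_ge_self[of rD] by argo
    moreover have "norm (z - z0) \<le> R / 16"
      unfolding R_def using z norm_triangle_ineq4[of z z0] abs_ge_zero[of rD] by argo
    ultimately have "norm (h z) \<le> Q * R ^ (kp + n)" by (rule main)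
    thus "norm (h z) \<le> (Q * 32 ^ (kp + n)) * norm z ^ (kp + n)"
      by (simp add: R_def power_mult_distrib)
  qed
qed

subsection \<open>Power series with algebraic coefficients\<close>

definition algebraic_fps :: "complex fps \<Rightarrow> bool" where
  "algebraic_fps F \<longleftrightarrow> (\<forall>n. algebraic (fps_nth F n))"

lemma algebraic_fps_mult: "algebraic_fps F \<Longrightarrow> algebraic_fps G \<Longrightarrow> algebraic_fps (F * G)"
  by (simp add: algebraic_fps_def fps_mult_nth algebraic_sum algebraic_mult)

lemma algebraic_fps_sum: "(\<And>i. i \<in> A \<Longrightarrow> algebraic_fps (F i)) \<Longrightarrow> algebraic_fps (\<Sum>i\<in>A. F i)"
  by (simp add: algebraic_fps_def fps_sum_nth algebraic_sum)

lemma algebraic_fps_deriv: "algebraic_fps F \<Longrightarrow> algebraic_fps (fps_deriv F)"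
  using algebraic_of_nat[of "Suc n" for n]
  by (simp add: algebraic_fps_def algebraic_mult del: of_nat_Suc)

lemma algebraic_fps_higher_deriv: "algebraic_fps F \<Longrightarrow> algebraic_fps ((fps_deriv ^^ n) F)"
  by (induction n) (simp_all add: algebraic_fps_deriv)

lemma algebraic_fps_of_poly: "p \<in> poly_Qbar \<Longrightarrow> algebraic_fps (fps_of_poly p)"
  by (simp add: algebraic_fps_def poly_Qbar_def)

text \<open>With \<open>k\<close> the order of \<open>F\<close>, the coefficient of
  \<open>F * G\<close> at \<open>k + n\<close> is \<open>fps_nth F k * fps_nth G n\<close> plus
  terms in earlier coefficients of \<open>G\<close>; solve for \<open>fps_nth G n\<close>.\<close>

lemma algebraic_fps_cancel:
  assumes "F \<noteq> 0" "algebraic_fps F" "algebraic_fps (F * G)"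
  shows "algebraic_fps G"
  unfolding algebraic_fps_def
proof
  fix n
  define k where "k = subdegree F"
  have k: "fps_nth F k \<noteq> 0" using assms(1) by (simp add: k_def)
  show "algebraic (fps_nth G n)"
  proof (induction n rule: less_induct)
    case (less n)
    have "fps_nth (F * G) (k + n) = fps_nth F k * fps_nth G n +
        (\<Sum>i\<in>{0..k + n} - {k}. fps_nth F i * fps_nth G (k + n - i))"
      by (simp add: fps_mult_nth sum.remove[of "{0..k + n}" k])
    hence "fps_nth G n = (fps_nth (F * G) (k + n) -
        (\<Sum>i\<in>{0..k + n} - {k}. fps_nth F i * fps_nth G (k + n - i))) / fps_nth F k"
      using k by (simp add: field_simps)
    moreover have "algebraic (fps_nth F i * fps_nth G (k + n - i))" if "i \<in> {0..k + n} - {k}" for i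
    proof (cases "i < k")
      case True
      hence "fps_nth F i = 0" unfolding k_def by (rule nth_less_subdegree_zero)
      thus ?thesis by simp
    next
      case False
      hence "k + n - i < n" using that by auto
      thus ?thesis
        using assms(2) by (intro algebraic_mult less) (simp_all add: algebraic_fps_def)
    qed
    moreover have "algebraic (fps_nth F k)" "algebraic (fps_nth (F * G) (k + n))"
      using assms(2,3) unfolding algebraic_fps_def by blast+
    ultimately show ?case
      by (simp only: algebraic_divide algebraic_diff algebraic_sum)
  qed
qed

lemma fps_nth_euler: "fps_nth (fps_X * fps_deriv F) n = of_nat n * fps_nth F n"
  by (cases n) simp_all

text \<open>
  Comparing coefficients in \<open>F \<sqdot> \<theta>(F\<^sup>m) = m \<sqdot> F\<^sup>m \<sqdot> \<theta>F\<close>, where \<open>\<theta> = x (d/dx)\<close>, determines the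
  coefficients of \<open>F\<close> recursively from those of \<open>F\<^sup>m\<close>.
\<close>

lemma algebraic_fps_of_power:
  assumes alg: "algebraic_fps (F ^ m)" and m: "m > 0"
  shows "algebraic_fps F"
proof (cases "F = 0")
  case True
  thus ?thesis by (simp add: algebraic_fps_def)
next
  case False
  define P where "P = F ^ m"
  define k where "k = subdegree F"
  define d where "d = m * k"
  have P: "fps_nth P j = 0" if "j < d" for j
    using that by (intro nth_less_subdegree_zero) (simp add: P_def d_def k_def)
  have Pd: "fps_nth P d = fps_nth F k ^ m" by (simp add: P_def d_def k_def)
  have Fk: "fps_nth F k \<noteq> 0" using False by (simp add: k_def)
  hence Pd0: "fps_nth P d \<noteq> 0" by (simp add: Pd)
  have algP: "algebraic (fps_nth P j)" for j using alg by (simp add: P_def algebraic_fps_def)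
  have "F * F ^ (m - 1) = P" using m by (simp add: P_def power_eq_if)
  moreover have "F * (fps_X * fps_deriv P) = fps_const (of_nat m) * ((fps_X * fps_deriv F) * (F * F ^ (m - 1)))"
    by (simp only: P_def fps_deriv_power mult_ac)
  ultimately have eq: "F * (fps_X * fps_deriv P) = fps_const (of_nat m) * ((fps_X * fps_deriv F) * P)"
    by simp
  have euler: "(\<Sum>i=0..n. fps_nth F i * (of_nat (n - i) * fps_nth P (n - i))) =
      (\<Sum>i=0..n. of_nat m * (of_nat i * fps_nth F i * fps_nth P (n - i)))" for n
  proof -
    have "fps_nth (F * (fps_X * fps_deriv P)) n = fps_nth (fps_const (of_nat m) * ((fps_X * fps_deriv F) * P)) n"
      by (simp only: eq)
    thus ?thesis
      by (simp only: fps_mult_left_const_nth fps_mult_nth[of F "fps_X * fps_deriv P"]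
          fps_mult_nth[of "fps_X * fps_deriv F" P] fps_nth_euler sum_distrib_left)
  qed
  have algk: "algebraic (fps_nth F (k + n))" for n
  proof (induction n rule: less_induct)
    case (less n)
    show ?case
    proof (cases "n = 0")
      case True
      \<comment> \<open>The recursion is void for \<open>n = 0\<close>; the leading coefficient is
        an m-th root of that of \<open>P\<close>.\<close>
      thus ?thesis using algebraic_of_power[of "fps_nth F k" m] algP[of d] Pd m by simp
    next
      case n: False
      \<comment> \<open>Difference of the two sides at index \<open>k + n + d\<close>. As
        \<open>d = m * k\<close>, the factor at \<open>i = k + n\<close> is d - m(k + n) = -mn,
        nonzero for \<open>n > 0\<close>. Beyond \<open>k + n\<close> the index of \<open>P\<close>
        drops below its order \<open>d\<close>.\<close>
      let ?t = "\<lambda>i. (of_nat (k + n + d - i) - of_nat m * of_nat i) * fps_nth F i * fps_nth P (k + n + d - i)"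
      have "0 = (\<Sum>i=0..k + n + d. ?t i)"
        using euler[of "k + n + d"] by (simp add: sum_subtractf ring_distribs mult_ac)
      also have "\<dots> = ?t (k + n) + (\<Sum>i\<in>{0..k + n + d} - {k + n}. ?t i)"
        by (rule sum.remove) auto
      also have "?t (k + n) = - (of_nat (m * n) * fps_nth P d) * fps_nth F (k + n)"
        by (simp add: d_def algebra_simps)
      finally have "fps_nth F (k + n) =
          (\<Sum>i\<in>{0..k + n + d} - {k + n}. ?t i) / (of_nat (m * n) * fps_nth P d)"
        using Pd0 m n by (simp add: eq_divide_eq mult_ac add_eq_0_iff2)
      moreover have "algebraic (?t i)" if "i \<in> {0..k + n + d} - {k + n}" for i
      proof (cases "i < k + n")
        case True
        have "algebraic (fps_nth F i)"
        proof (cases "i < k")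
          case False
          hence "algebraic (fps_nth F (k + (i - k)))" using True by (intro less) simp
          thus ?thesis using False by simp
        next
          case True
          hence "fps_nth F i = 0" unfolding k_def by (rule nth_less_subdegree_zero)
          thus ?thesis by simp
        qed
        thus ?thesis
          by (intro algebraic_mult algebraic_diff algebraic_of_nat algP)
      next
        case False
        hence "fps_nth P (k + n + d - i) = 0" using that by (intro P) auto
        thus ?thesis by simp
      qed
      ultimately show ?thesis
        by (simp only: algebraic_divide algebraic_sum algebraic_mult algebraic_of_nat algP)
    qed
  qed
  show ?thesis unfolding algebraic_fps_def
  proof
    fix n
    show "algebraic (fps_nth F n)"
    proof (cases "n < k")
      case True
      hence "fps_nth F n = 0" unfolding k_def by (rule nth_less_subdegree_zero)
      thus ?thesis by simp
    next
      case False
      thus ?thesis using algk[of "n - k"] by simp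
    qed
  qed
qed

subsection \<open>The quotient of \<open>L(g)\<close> by \<open>g\<close>\<close>

text \<open>\<open>D\<close> is the product of all denominators. Values are compared only off its
  zeros, since division by zero would make the two sides disagree at cancelled factors.\<close>

lemma clear_denominators:
  assumes "L \<in> diffop_Qbar"
  obtains D p where "D \<noteq> 0" "D \<in> poly_Qbar" "\<And>i. p i \<in> poly_Qbar"
    "\<And>i z. i \<le> degree L \<Longrightarrow> poly D z \<noteq> 0 \<Longrightarrow> eval_ratfun (coeff L i) z = poly (p i) z / poly D z"
proof -
  have "\<forall>i. \<exists>a b. coeff L i = Fraction_Field.Fract a b \<and> a \<in> poly_Qbar \<and> b \<in> poly_Qbar \<and> b \<noteq> 0"
    using assms unfolding diffop_Qbar_def ratfun_Qbar_def by auto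
  then obtain a b where ab: "\<And>i. coeff L i = Fraction_Field.Fract (a i) (b i)"
    "\<And>i. a i \<in> poly_Qbar" "\<And>i. b i \<in> poly_Qbar" "\<And>i. b i \<noteq> 0"
    by metis
  show thesis
  proof (rule that[of "\<Prod>i\<le>degree L. b i" "\<lambda>i. a i * (\<Prod>j\<in>{..degree L} - {i}. b j)"])
    fix i z assume i: "i \<le> degree L" and nz: "poly (\<Prod>i\<le>degree L. b i) z \<noteq> 0"
    have split: "(\<Prod>i\<le>degree L. b i) = b i * (\<Prod>j\<in>{..degree L} - {i}. b j)"
      using i by (intro prod.remove) auto
    show "eval_ratfun (coeff L i) z =
        poly (a i * (\<Prod>j\<in>{..degree L} - {i}. b j)) z / poly (\<Prod>i\<le>degree L. b i) z"
      using nz unfolding split ab(1) by (subst eval_ratfun_Fract) auto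
  qed (use ab in \<open>auto intro!: poly_Qbar_mult poly_Qbar_prod\<close>)
qed

lemma has_fps_expansion_poly: "poly p has_fps_expansion fps_of_poly p" for p :: "complex poly"
  by (simp add: has_fps_expansion_def)

lemma has_fps_expansion_higher_deriv:
  "f has_fps_expansion F \<Longrightarrow> (deriv ^^ n) f has_fps_expansion (fps_deriv ^^ n) F"
  for f :: "complex \<Rightarrow> complex"
  by (induction n) (auto intro: has_fps_expansion_deriv)

text \<open>The exceptional points of the hypothesis and the zeros of \<open>g\<close> and
  \<open>D\<close> are isolated, so the identity holds in a punctured neighbourhood of every point
  and extends to the point by continuity.\<close>

lemma diffop_equation:
  assumes g: "g holomorphic_on UNIV" and gnz: "g z0 \<noteq> 0" and h: "h holomorphic_on UNIV"
    and ae: "\<forall>\<^sub>\<approx>z. h z = diffop_fun L g z / g z" and D: "D \<noteq> 0"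
    and p: "\<And>i z. i \<le> degree L \<Longrightarrow> poly D z \<noteq> 0 \<Longrightarrow>
      eval_ratfun (coeff L i) z = poly (p i) z / poly D z"
  shows "poly D z * h z * g z = (\<Sum>i\<le>degree L. poly (p i) z * (deriv ^^ i) g z)"
proof -
  let ?l = "\<lambda>z. poly D z * h z * g z" and ?r = "\<lambda>z. \<Sum>i\<le>degree L. poly (p i) z * (deriv ^^ i) g z"
  have 1: "\<forall>\<^sub>F w in at z. h w = diffop_fun L g w / g w"
    using ae by (rule eventually_cosparse_imp_eventually_at) simp
  have 2: "\<forall>\<^sub>F w in at z. g w \<noteq> 0"
    using non_zero_neighbour_alt[OF g open_UNIV connected_UNIV UNIV_I UNIV_I gnz, of z] by simp
  obtain z1 where "poly D z1 \<noteq> 0" using D poly_all_0_iff_0 by blast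
  hence 3: "\<forall>\<^sub>F w in at z. poly D w \<noteq> 0"
    using non_zero_neighbour_alt[of "poly D" UNIV z z1] connected_UNIV
    by (simp add: holomorphic_intros)
  have "\<forall>\<^sub>F w in at z. ?l w = ?r w"
    using 1 2 3
  proof eventually_elim
    case (elim w)
    have "poly D w * h w * g w = poly D w * diffop_fun L g w" using elim by simp
    also have "\<dots> = ?r w"
      using elim(3) p[OF _ elim(3)] by (simp add: diffop_fun_def sum_distrib_left)
    finally show ?case .
  qed
  moreover have "isCont ?l z"
  proof -
    have "?l holomorphic_on UNIV" by (intro holomorphic_intros g h)
    from holomorphic_on_imp_continuous_on[OF this] show ?thesis
      by (simp add: continuous_on_eq_continuous_at)
  qed
  ultimately have "?r \<midarrow>z\<rightarrow> ?l z"
    unfolding isCont_def by (rule Lim_transform_eventually[rotated])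
  moreover have "?r \<midarrow>z\<rightarrow> ?r z"
  proof -
    have "?r holomorphic_on UNIV" by (intro holomorphic_intros g open_UNIV)
    from holomorphic_on_imp_continuous_on[OF this] have "isCont ?r z"
      by (simp add: continuous_on_eq_continuous_at)
    thus ?thesis unfolding isCont_def .
  qed
  ultimately show ?thesis by (rule tendsto_unique[OF trivial_limit_at])
qed

theorem theorem1:
  fixes g h :: "complex \<Rightarrow> complex" and m :: nat and L :: "complex poly fract poly"
  assumes "g holomorphic_on UNIV"
    and "\<exists>z. g z \<noteq> 0"
    and "m \<ge> 1"
    and "E_function (fps_expansion (\<lambda>z. g z ^ m) 0)"
    and "L \<in> diffop_Qbar"
    and "h holomorphic_on UNIV"
    and "\<forall>\<^sub>\<approx>z. h z = diffop_fun L g z / g z"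
  shows "\<exists>p\<in>poly_Qbar. \<forall>z. h z = poly p z"
proof -
  note g = assms(1) and m = assms(3) and h = assms(6)
  obtain z0 where z0: "g z0 \<noteq> 0" using assms(2) by blast
  obtain D p where D: "D \<noteq> 0" "D \<in> poly_Qbar" and p: "\<And>i. p i \<in> poly_Qbar"
    "\<And>i z. i \<le> degree L \<Longrightarrow> poly D z \<noteq> 0 \<Longrightarrow> eval_ratfun (coeff L i) z = poly (p i) z / poly D z"
    by (rule clear_denominators[OF assms(5)], rule that)
  have eq: "poly D z * h z * g z = (\<Sum>i\<le>degree L. poly (p i) z * (deriv ^^ i) g z)" for z
    by (rule diffop_equation[OF g z0 h assms(7) D(1)]) (rule p(2))

  have gm: "(\<lambda>z. g z ^ m) holomorphic_on UNIV" by (intro holomorphic_intros g)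
  obtain C where C: "C > 0" "\<And>z. norm (g z ^ m) \<le> C * exp (C * norm z)"
    by (rule E_function_exponential_type[OF gm assms(4)], rule that)
  have growth: "norm (g z) \<le> (1 + C) * exp (C * norm z)" for z
    by (rule exponential_type_of_power[OF C m])
  have C1: "1 + C > 0" using C(1) by simp
  obtain A B k where hk: "\<And>z. A \<le> norm z \<Longrightarrow> norm (h z) \<le> B * norm z ^ k"
    by (rule polynomial_growth_of_quotient[OF g h z0 C(1) C1 growth D(1) eq], rule that)

  define \<gamma> \<eta> where "\<gamma> = fps_expansion g 0" and "\<eta> = fps_expansion h 0"
  have \<gamma>: "g has_fps_expansion \<gamma>" and \<eta>: "h has_fps_expansion \<eta>"
    unfolding \<gamma>_def \<eta>_def
    by (rule has_fps_expansion_fps_expansion[OF open_UNIV UNIV_I g],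
        rule has_fps_expansion_fps_expansion[OF open_UNIV UNIV_I h])
  have "fps_expansion (\<lambda>z. g z ^ m) 0 = \<gamma> ^ m"
    using has_fps_expansion_fps_expansion[OF open_UNIV UNIV_I gm] has_fps_expansion_power[OF \<gamma>]
    by (rule fps_expansion_unique_complex)
  hence "algebraic (fact n * fps_nth (\<gamma> ^ m) n)" for n
    using assms(4) by (simp add: E_function_def egf_coeff_def)
  \<comment> \<open>The definition of an E-function speaks of n! times the Taylor
    coefficient.\<close>
  hence "algebraic (fact n * fps_nth (\<gamma> ^ m) n / of_nat (fact n))" for n
    by (intro algebraic_divide algebraic_of_nat)
  hence "algebraic_fps (\<gamma> ^ m)" by (simp add: algebraic_fps_def)
  hence alg_\<gamma>: "algebraic_fps \<gamma>" by (rule algebraic_fps_of_power) (use m in simp)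
  have \<gamma>0: "\<gamma> \<noteq> 0"
  proof
    assume "\<gamma> = 0"
    hence "g has_fps_expansion 0" using \<gamma> by simp
    from has_fps_expansion_0_analytic_continuation[OF this g open_UNIV connected_UNIV UNIV_I UNIV_I, of z0]
    show False using z0 by simp
  qed
  \<comment> \<open>Read as power series at 0, the right-hand side has algebraic coefficients, and
    the nonzero series of \<open>D\<close> and \<open>g\<close> can be cancelled on the
    left.\<close>
  have "(\<lambda>z. poly D z * h z * g z) has_fps_expansion (fps_of_poly D * \<eta> * \<gamma>)"
    by (intro has_fps_expansion_mult has_fps_expansion_poly \<gamma> \<eta>)
  moreover have "(\<lambda>z. \<Sum>i\<le>degree L. poly (p i) z * (deriv ^^ i) g z) has_fps_expansion
      (\<Sum>i\<le>degree L. fps_of_poly (p i) * (fps_deriv ^^ i) \<gamma>)"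
    by (intro has_fps_expansion_sum has_fps_expansion_mult has_fps_expansion_poly
        has_fps_expansion_higher_deriv \<gamma>)
  ultimately have "fps_of_poly D * \<eta> * \<gamma> = (\<Sum>i\<le>degree L. fps_of_poly (p i) * (fps_deriv ^^ i) \<gamma>)"
    unfolding eq by (rule fps_expansion_unique_complex)
  moreover have "algebraic_fps (\<Sum>i\<le>degree L. fps_of_poly (p i) * (fps_deriv ^^ i) \<gamma>)"
    by (intro algebraic_fps_sum algebraic_fps_mult algebraic_fps_of_poly p(1)
        algebraic_fps_higher_deriv alg_\<gamma>)
  ultimately have "algebraic_fps (fps_of_poly D * \<gamma> * \<eta>)" by (simp add: mult_ac)
  hence alg_\<eta>: "algebraic_fps \<eta>"
    using D \<gamma>0 fps_of_poly_eq_iff[of D 0] alg_\<gamma>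
    by (intro algebraic_fps_cancel[of "fps_of_poly D * \<gamma>" \<eta>])
      (auto intro: algebraic_fps_mult algebraic_fps_of_poly)

  \<comment> \<open>By Liouville's theorem \<open>h\<close> equals its Taylor polynomial of degree
    \<open>k\<close>, whose coefficients were just shown to be algebraic.\<close>
  define q where "q = (\<Sum>i\<le>k. monom (fps_nth \<eta> i) i)"
  show ?thesis
  proof (intro bexI allI)
    show "q \<in> poly_Qbar"
      using alg_\<eta> by (simp add: q_def poly_Qbar_def coeff_sum algebraic_fps_def)
    fix z
    have "h z = (\<Sum>i\<le>k. (deriv ^^ i) h 0 / fact i * z ^ i)"
      by (rule Liouville_polynomial[OF h]) (rule hk)
    thus "h z = poly q z"
      by (simp add: q_def poly_sum poly_monom \<eta>_def fps_expansion_def)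
  qed
qed

end
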